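(* Let $N\ge2$, $c_g>0$, $c_\sigma>0$, and for $\xi'\in\mathbf R^{N-1}\setminus\{0\}$ put $A=|\xi'|$. Let $\lambda_\pm$ be the zeros of the Lopatinskii determinant defined by $\lambda_\pm=(B_1^\pm)^2-A^2$, where $B_1^\pm$ are the two roots with positive real part (for small $A>0$) of the degree-four polynomial $B\mapsto L(A,B)$. Then $$\lambda_\pm=\pm i\,c_g^{1/2}|\xi'|^{1/2}-2|\xi'|^2+O(|\xi'|^{5/2})\qquad\text{as }|\xi'|\to0.$$
   Context: The Lopatinskii determinant is $L(A,B)=(B-A)D(A,B)+A(c_g+c_\sigma A^2)$ with $D(A,B)=B^3+AB^2+3A^2B-A^3$, where $A=|\xi'|$ and $B=\sqrt{\lambda+|\xi'|^2}$, $\mathrm{Re}\,B\ge0$. As $A\to0$ the four roots in $B$ of $L(A,B)$ behave like $e^{\pm i\pi/4}c_g^{1/4}A^{1/4}$ (denoted $B_1^\pm$) and $e^{\pm 3i\pi/4}c_g^{1/4}A^{1/4}$ (denoted $B_2^\pm$) to leading order. *)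

theory Defs
  imports "HOL-Analysis.Analysis" "HOL-Library.Landau_Symbols"
begin

definition lopatinskii_D :: "real \<Rightarrow> complex \<Rightarrow> complex" where
  "lopatinskii_D A B =
     B^3 + of_real A * B^2 + 3 * of_real A ^ 2 * B - of_real A ^ 3"

definition lopatinskii_L :: "real \<Rightarrow> real \<Rightarrow> real \<Rightarrow> complex \<Rightarrow> complex" where
  "lopatinskii_L c_g c_\<sigma> A B =
     (B - of_real A) * lopatinskii_D A B + of_real (A * (c_g + c_\<sigma> * A^2))"

text \<open>\<^const>\<open>csqrt\<close> is the square root with nonnegative real part, as required of \<open>B\<close>.\<close>

definition symbol_B :: "real \<Rightarrow> complex \<Rightarrow> complex" where
  "symbol_B A z = csqrt (z + of_real A ^ 2)"

text \<open>
  The functions \<open>Bp\<close> and \<open>Bm\<close> of \<open>A\<close> are the branches \<open>B\<^sub>1\<^sup>+\<close> and \<open>B\<^sub>1\<^sup>-\<close>: for small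
  \<open>A > 0\<close> they are exactly the two roots with positive real part, and they are told apart
  by their leading-order behaviour. This determines them uniquely for small \<open>A > 0\<close>;
  their values for other \<open>A\<close> are irrelevant.
\<close>

definition B1_branches ::
    "real \<Rightarrow> real \<Rightarrow> (real \<Rightarrow> complex) \<Rightarrow> (real \<Rightarrow> complex) \<Rightarrow> bool" where
  "B1_branches c_g c_\<sigma> Bp Bm \<longleftrightarrow>
     (\<forall>\<^sub>F A in at_right 0. Bp A \<noteq> Bm A \<and>
        {B. lopatinskii_L c_g c_\<sigma> A B = 0 \<and> 0 < Re B} = {Bp A, Bm A}) \<and>
     Bp \<sim>[at_right 0]
       (\<lambda>A. exp (\<i> * of_real pi / 4) * of_real (c_g powr (1/4) * A powr (1/4))) \<and>
     Bm \<sim>[at_right 0]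
       (\<lambda>A. exp (- \<i> * of_real pi / 4) * of_real (c_g powr (1/4) * A powr (1/4)))"

definition root_lambda :: "(real \<Rightarrow> complex) \<Rightarrow> real \<Rightarrow> complex" where
  "root_lambda B A = (B A)^2 - of_real A ^ 2"

end

theory Submission
  imports Defs "HOL-Computational_Algebra.Fundamental_Theorem_Algebra"
    "HOL-Real_Asymp.Real_Asymp"
begin

text \<open>
  Expanding, \<open>L(A,B) = (B\<^sup>2 + A\<^sup>2)\<^sup>2 - 4 A\<^sup>3 B + c\<^sub>g A + c\<^sub>\<sigma> A\<^sup>3\<close>, and \<open>B\<^sup>2 + A\<^sup>2 = \<lambda> + 2 A\<^sup>2\<close>.
  So for a root \<open>B\<close> the number \<open>w = \<lambda> + 2 A\<^sup>2\<close> satisfies \<open>w\<^sup>2 = w\<^sub>0\<^sup>2 + O(A\<^sup>3)\<close> with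
  \<open>w\<^sub>0 = \<plusminus>i (c\<^sub>g A)\<^bsup>1/2\<^esup>\<close>, and dividing \<open>w\<^sup>2 - w\<^sub>0\<^sup>2\<close> by \<open>w + w\<^sub>0\<close>, which has order \<open>A\<^bsup>1/2\<^esup>\<close>, gives
  \<open>w - w\<^sub>0 = O(A\<^bsup>5/2\<^esup>)\<close>. The branches exist because a monic quartic has a root within
  \<open>|p(z)|\<^bsup>1/4\<^esup>\<close> of any point \<open>z\<close>: applied at the four leading-order approximations, this
  produces one root in each open quadrant, hence all the roots.
\<close>

section \<open>Distance from a point to the nearest root of a monic polynomial\<close>

lemma power_size_le_prod_mset:
  fixes f :: "'a \<Rightarrow> real"
  assumes "\<And>x. x \<in># M \<Longrightarrow> m \<le> f x" and "0 \<le> m"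
  shows "m ^ size M \<le> (\<Prod>x\<in>#M. f x)"
  using assms(1)
proof (induction M)
  case (add x M)
  then show ?case
    using assms(2) order_trans[OF assms(2), of "f x"] by (auto intro!: mult_mono)
qed simp

text \<open>Over the complex numbers \<open>p\<close> splits into monic linear factors, so
  \<open>cmod (poly p z)\<close> is the product of the distances from \<open>z\<close> to the roots,
  and each factor is at least the distance to a nearest root \<open>r\<close>.\<close>

lemma monic_poly_root_near:
  fixes p :: "complex poly"
  assumes "lead_coeff p = 1" and "degree p > 0"
  obtains r where "poly p r = 0" and "cmod (z - r) ^ degree p \<le> cmod (poly p z)"
proof -
  have "p \<noteq> 0" using assms(2) by auto
  then obtain M where M: "size M = degree p" "p = smult (lead_coeff p) (\<Prod>x\<in>#M. [:-x, 1:])"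
    using alg_closed_imp_factorization by blast
  have eval: "poly p y = (\<Prod>x\<in>#M. y - x)" for y
    by (subst M(2)) (simp add: assms(1) poly_prod_mset image_mset.compositionality o_def)
  have "set_mset M \<noteq> {}" using M(1) assms(2) by auto
  then obtain r where r: "r \<in># M" "\<And>x. x \<in># M \<Longrightarrow> cmod (z - r) \<le> cmod (z - x)"
    using ex_min_if_finite[of "(\<lambda>x. cmod (z - x)) ` set_mset M"]
    by (metis (no_types, lifting) finite_imageI finite_set_mset image_iff image_is_empty linorder_not_less)
  have "cmod (\<Prod>x\<in>#M. z - x) = (\<Prod>x\<in>#M. cmod (z - x))"
    by (induction M) (simp_all add: norm_mult)
  moreover have "poly p r = 0"
    unfolding eval using r(1) by (auto simp: image_iff)
  ultimately show thesis
    using that[of r] power_size_le_prod_mset[of M "cmod (z - r)" "\<lambda>x. cmod (z - x)"] r(2) M(1)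
    by (simp add: eval)
qed

section \<open>The determinant as a monic quartic in \<open>B\<close>\<close>

lemma lopatinskii_L_expand:
  "lopatinskii_L c_g c_\<sigma> A B =
    (B\<^sup>2 + of_real A ^ 2)\<^sup>2 - 4 * of_real A ^ 3 * B + of_real (c_g * A + c_\<sigma> * A ^ 3)"
  unfolding lopatinskii_L_def lopatinskii_D_def
  by (simp add: algebra_simps power2_eq_square power3_eq_cube)

definition lopatinskii_poly :: "real \<Rightarrow> real \<Rightarrow> real \<Rightarrow> complex poly" where
  "lopatinskii_poly c_g c_\<sigma> A =
    [:of_real (A ^ 4 + c_g * A + c_\<sigma> * A ^ 3), - 4 * of_real A ^ 3, 2 * of_real A ^ 2, 0, 1:]"

lemma poly_lopatinskii_poly:
  "poly (lopatinskii_poly c_g c_\<sigma> A) B = lopatinskii_L c_g c_\<sigma> A B"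
  unfolding lopatinskii_L_expand lopatinskii_poly_def
  by (simp add: algebra_simps power2_eq_square power3_eq_cube power4_eq_xxxx)

lemma degree_lopatinskii_poly: "degree (lopatinskii_poly c_g c_\<sigma> A) = 4"
  and lead_coeff_lopatinskii_poly: "lead_coeff (lopatinskii_poly c_g c_\<sigma> A) = 1"
  by (simp_all add: lopatinskii_poly_def)

section \<open>The leading-order scale and roots that follow it\<close>

text \<open>The common modulus of the four leading-order approximations, that is, the fourth root of
  \<open>c_g * A\<close> for positive arguments.\<close>

definition branch_scale :: "real \<Rightarrow> real \<Rightarrow> real" where
  "branch_scale c_g A = c_g powr (1/4) * A powr (1/4)"

lemma branch_scale_pos: "c_g > 0 \<Longrightarrow> A > 0 \<Longrightarrow> branch_scale c_g A > 0"
  by (simp add: branch_scale_def)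

lemma branch_scale_power2:
  "c_g > 0 \<Longrightarrow> A > 0 \<Longrightarrow> branch_scale c_g A ^ 2 = c_g powr (1/2) * A powr (1/2)"
  unfolding branch_scale_def
  by (simp add: power_mult_distrib powr_power)

lemma branch_scale_power4:
  assumes "c_g > 0" "A > 0"
  shows "branch_scale c_g A ^ 4 = c_g * A"
proof -
  have "branch_scale c_g A ^ 4 = (branch_scale c_g A ^ 2) ^ 2" by simp
  also have "\<dots> = (c_g powr (1/2))\<^sup>2 * (A powr (1/2))\<^sup>2"
    using assms by (simp only: branch_scale_power2 power_mult_distrib)
  also have "\<dots> = c_g * A"
    using assms by (simp add: powr_half_sqrt)
  finally show ?thesis .
qed

lemma tendsto_branch_scale: "c_g > 0 \<Longrightarrow> (branch_scale c_g \<longlongrightarrow> 0) (at_right 0)"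
  unfolding branch_scale_def by real_asymp

text \<open>Write h for \<open>branch_scale c_g A\<close>. At \<open>\<zeta>\<close> h the terms
  \<open>B^4\<close> and \<open>c_g * A\<close> of the determinant cancel and leave o(A), so the
  nearest root is at distance o(h). The root is chosen separately for each \<open>A\<close>.\<close>

lemma lopatinskii_root_branch:
  fixes \<zeta> :: complex
  assumes "\<zeta> ^ 4 = - 1" and "c_g > 0"
  obtains R where "\<And>A. lopatinskii_L c_g c_\<sigma> A (R A) = 0"
    and "((\<lambda>A. R A / of_real (branch_scale c_g A)) \<longlongrightarrow> \<zeta>) (at_right 0)"
proof -
  let ?h = "branch_scale c_g"
  have "\<exists>r. lopatinskii_L c_g c_\<sigma> A r = 0 \<and>
      cmod (\<zeta> * of_real (?h A) - r) ^ 4 \<le> cmod (lopatinskii_L c_g c_\<sigma> A (\<zeta> * of_real (?h A)))" for A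
    using monic_poly_root_near[of "lopatinskii_poly c_g c_\<sigma> A" "\<zeta> * of_real (?h A)",
        OF lead_coeff_lopatinskii_poly]
    unfolding degree_lopatinskii_poly poly_lopatinskii_poly by auto
  then obtain R where R: "\<And>A. lopatinskii_L c_g c_\<sigma> A (R A) = 0"
    and near: "\<And>A. cmod (\<zeta> * of_real (?h A) - R A) ^ 4
      \<le> cmod (lopatinskii_L c_g c_\<sigma> A (\<zeta> * of_real (?h A)))"
    by metis
  have "cmod \<zeta> ^ 4 = 1" using assms(1) by (metis norm_minus_cancel norm_one norm_power)
  then have norm_zeta: "cmod \<zeta> = 1"
    using power_eq_iff_eq_base[of 4 "cmod \<zeta>" 1] by simp
  \<comment> \<open>The numerator is the triangle-inequality bound for the terms left after the
    cancellation, with \<open>cmod \<zeta> = 1\<close>; the denominator is h^4. The slowest term is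
    of order A^(3/2), so \<open>e\<close> tends to 0.\<close>
  define e where "e A =
    (2 * A ^ 2 * ?h A ^ 2 + A ^ 4 + 4 * A ^ 3 * ?h A + \<bar>c_\<sigma>\<bar> * A ^ 3) / (c_g * A)" for A
  have bound: "cmod (R A / of_real (?h A) - \<zeta>) \<le> root 4 (e A)" if "A > 0" for A
  proof -
    let ?z = "\<zeta> * of_real (?h A)"
    have h: "?h A > 0" "?h A ^ 4 = c_g * A"
      using branch_scale_pos branch_scale_power4 assms(2) that by auto
    have "?z ^ 4 = - of_real (c_g * A)"
      using assms(1) h(2) by (simp add: power_mult_distrib flip: of_real_power)
    then have L: "lopatinskii_L c_g c_\<sigma> A ?z
        = 2 * of_real A ^ 2 * ?z ^ 2 + of_real A ^ 4 - 4 * of_real A ^ 3 * ?z + of_real (c_\<sigma> * A ^ 3)"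
      unfolding lopatinskii_L_expand by (simp add: power2_sum)
    have "cmod (lopatinskii_L c_g c_\<sigma> A ?z)
        \<le> cmod (2 * of_real A ^ 2 * ?z ^ 2) + cmod (of_real A ^ 4)
          + cmod (4 * of_real A ^ 3 * ?z) + cmod (of_real (c_\<sigma> * A ^ 3))"
      unfolding L by (intro norm_triangle_mono order_refl
          order_trans[OF norm_triangle_ineq4] add_right_mono norm_triangle_ineq)
    also have "\<dots> = e A * (c_g * A)"
      using that h(1) assms(2)
      by (simp add: e_def norm_mult norm_power norm_zeta abs_mult power_mult_distrib
          del: of_real_mult of_real_power)
    finally have "cmod (?z - R A) ^ 4 \<le> e A * ?h A ^ 4"
      unfolding h(2) using near[of A] by (rule order_trans[rotated])
    moreover have "cmod (?z - R A) = cmod (R A / of_real (?h A) - \<zeta>) * ?h A"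
    proof -
      have "?z - R A = - ((R A / of_real (?h A) - \<zeta>) * of_real (?h A))"
        using h(1) by (simp add: field_simps)
      then show ?thesis using h(1) by (simp only: norm_minus_cancel norm_mult norm_of_real abs_of_pos)
    qed
    ultimately have "cmod (R A / of_real (?h A) - \<zeta>) ^ 4 \<le> e A"
      using h(1) by (simp add: power_mult_distrib)
    then have "root 4 (cmod (R A / of_real (?h A) - \<zeta>) ^ 4) \<le> root 4 (e A)"
      by (intro real_root_le_mono) auto
    then show ?thesis by (simp add: real_root_power_cancel)
  qed
  have "(e \<longlongrightarrow> 0) (at_right 0)"
    using assms(2) unfolding e_def branch_scale_def by real_asymp
  then have "((\<lambda>A. root 4 (e A)) \<longlongrightarrow> 0) (at_right 0)"
    using tendsto_real_root[of e 0 "at_right 0" 4] by simp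
  then have "((\<lambda>A. R A / of_real (?h A) - \<zeta>) \<longlongrightarrow> 0) (at_right 0)"
    by (rule Lim_null_comparison[rotated])
       (use eventually_at_right_less[of 0] bound in \<open>auto elim: eventually_mono\<close>)
  then show thesis using that R Lim_null by blast
qed

section \<open>Expansion of lambda along a branch\<close>

text \<open>Here \<open>s\<close> is \<open>\<i>\<close> or \<open>- \<i>\<close>, so one argument
  serves both signs. The difference to be estimated is w - s h^2 with w = R^2 + A^2 and h =
  \<open>branch_scale c_g A\<close>.\<close>

lemma root_lambda_expansion:
  fixes \<zeta> s :: complex
  assumes "\<zeta> ^ 2 = s" and "s ^ 2 = - 1" and c: "c_g > 0"
    and lim: "((\<lambda>A. R A / of_real (branch_scale c_g A)) \<longlongrightarrow> \<zeta>) (at_right 0)"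
    and root: "\<forall>\<^sub>F A in at_right 0. lopatinskii_L c_g c_\<sigma> A (R A) = 0"
  shows "(\<lambda>A. root_lambda R A - (s * of_real (c_g powr (1/2) * A powr (1/2)) - 2 * of_real A ^ 2))
    \<in> O[at_right 0](\<lambda>A. of_real (A powr (5/2)))"
proof (rule bigoI_tendsto)
  let ?h = "branch_scale c_g"
  \<comment> \<open>This is the cofactor w + s h^2 divided by its order h^2. Since (R/h)^2 tends to
    \<open>s\<close> and (A/h)^2 to 0, it tends to \<open>2 * s\<close>, which is nonzero, so
    division by it is eventually legitimate.\<close>
  define u where "u A = (R A ^ 2 + of_real A ^ 2) / of_real (?h A) ^ 2 + s" for A
  have pos: "\<forall>\<^sub>F A in at_right 0. A > (0::real)"
    by (rule eventually_at_right_less)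
  have "((\<lambda>A. of_real ((A / ?h A) ^ 2)) \<longlongrightarrow> (of_real 0 :: complex)) (at_right 0)"
    using c unfolding branch_scale_def by (intro tendsto_of_real) real_asymp
  then have "((\<lambda>A. (R A / of_real (?h A)) ^ 2 + of_real ((A / ?h A) ^ 2) + s)
      \<longlongrightarrow> \<zeta> ^ 2 + of_real 0 + s) (at_right 0)"
    by (intro tendsto_add tendsto_power tendsto_const lim)
  then have u: "(u \<longlongrightarrow> 2 * s) (at_right 0)"
    by (simp add: u_def[abs_def] assms(1) power_divide add_divide_distrib)
  have "s \<noteq> 0" using assms(2) by auto
  then have u0: "\<forall>\<^sub>F A in at_right 0. u A \<noteq> 0"
    using tendsto_imp_eventually_ne[OF u, of 0] by simp
  have "((\<lambda>A. R A / of_real (?h A) * of_real (?h A)) \<longlongrightarrow> \<zeta> * of_real 0) (at_right 0)"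
    by (intro tendsto_intros lim tendsto_branch_scale c)
  moreover have "\<forall>\<^sub>F A in at_right 0. R A / of_real (?h A) * of_real (?h A) = R A"
    using pos by eventually_elim (use branch_scale_pos[OF c] in \<open>force simp: field_simps\<close>)
  ultimately have R0: "(R \<longlongrightarrow> 0) (at_right 0)"
    by (simp add: tendsto_cong)
  \<comment> \<open>The closed form of (w - s h^2) / A^(5/2): the root equation has right-hand side
    (4 R - \<open>c_\<sigma>\<close>) A^3, and dividing by u h^2 = u c_g^(1/2) A^(1/2) leaves
    A^(5/2). Its finite limit yields the O-bound.\<close>
  define g where "g A = (4 * R A - of_real c_\<sigma>) / (u A * of_real (c_g powr (1/2)))" for A
  have "(g \<longlongrightarrow> (4 * 0 - of_real c_\<sigma>) / (2 * s * of_real (c_g powr (1/2)))) (at_right 0)"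
    unfolding g_def using c \<open>s \<noteq> 0\<close> by (intro tendsto_intros R0 u) auto
  moreover have "\<forall>\<^sub>F A in at_right 0. g A =
      (root_lambda R A - (s * of_real (c_g powr (1/2) * A powr (1/2)) - 2 * of_real A ^ 2))
      / of_real (A powr (5/2))"
    using pos u0 root
  proof eventually_elim
    case (elim A)
    define w where "w = R A ^ 2 + of_real A ^ 2"
    define H where "H = (of_real (?h A) :: complex)"
    define a where "a = (of_real A :: complex)"
    have H: "H \<noteq> 0" using branch_scale_pos[OF c elim(1)] by (simp add: H_def)
    have H4: "H ^ 4 = of_real (c_g * A)"
      unfolding H_def using branch_scale_power4[OF c elim(1)] by (simp flip: of_real_power)
    have uw: "u A * H ^ 2 = w + s * H ^ 2"
      using H by (simp add: u_def w_def H_def field_simps)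
    have "w ^ 2 - 4 * a ^ 3 * R A + H ^ 4 + of_real c_\<sigma> * a ^ 3 = 0"
      using elim(3) unfolding lopatinskii_L_expand H4 a_def w_def by (simp add: algebra_simps)
    moreover have "(w - s * H\<^sup>2) * (w + s * H\<^sup>2) = w ^ 2 - s ^ 2 * H ^ 4"
      by (simp add: algebra_simps power2_eq_square power4_eq_xxxx)
    \<comment> \<open>Because \<open>s ^ 2 = - 1\<close>, the difference of squares equals w^2 +
      H^4, which the root equation evaluates.\<close>
    ultimately have key: "(w - s * H\<^sup>2) * (u A * H ^ 2) = (4 * R A - of_real c_\<sigma>) * a ^ 3"
      unfolding uw using assms(2) by (simp add: algebra_simps)
    have H2: "H ^ 2 = of_real (c_g powr (1/2) * A powr (1/2))"
      unfolding H_def using branch_scale_power2[OF c elim(1)] by (metis of_real_power)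
    have "A ^ 3 = A powr (5/2) * A powr (1/2)"
      using elim(1) by (simp flip: powr_add powr_numeral)
    then have a3: "a ^ 3 = of_real (A powr (5/2)) * of_real (A powr (1/2))"
      unfolding a_def by (metis of_real_mult of_real_power)
    have half: "of_real (A powr (1/2)) \<noteq> (0::complex)" using elim(1) by simp
    have "((w - s * H\<^sup>2) * (u A * of_real (c_g powr (1/2)))) * of_real (A powr (1/2))
        = ((4 * R A - of_real c_\<sigma>) * of_real (A powr (5/2))) * of_real (A powr (1/2))"
      using key unfolding a3 by (simp add: H2 mult_ac)
    then have "(w - s * H\<^sup>2) * (u A * of_real (c_g powr (1/2)))
        = (4 * R A - of_real c_\<sigma>) * of_real (A powr (5/2))"
      using half by (simp only: mult_cancel_right) simp
    then have "g A = (w - s * H\<^sup>2) / of_real (A powr (5/2))"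
      using elim(1,2) c by (simp add: g_def frac_eq_eq mult_ac)
    then show ?case
      by (simp add: root_lambda_def w_def H2 algebra_simps)
  qed
  ultimately show "((\<lambda>A. (root_lambda R A - (s * of_real (c_g powr (1/2) * A powr (1/2)) - 2 * of_real A ^ 2))
      / of_real (A powr (5/2))) \<longlongrightarrow> (4 * 0 - of_real c_\<sigma>) / (2 * s * of_real (c_g powr (1/2)))) (at_right 0)"
    by (rule Lim_transform_eventually)
  show "\<forall>\<^sub>F A in at_right 0. (of_real (A powr (5/2)) :: complex) \<noteq> 0"
    using pos by eventually_elim simp
qed

section \<open>Quadrants of the roots and existence of the branches\<close>

lemma exp_pi_quarter: "exp (\<i> * of_real pi / 4) = Complex (sqrt 2 / 2) (sqrt 2 / 2)"
  and exp_minus_pi_quarter: "exp (- \<i> * of_real pi / 4) = Complex (sqrt 2 / 2) (- (sqrt 2 / 2))"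
  using cis_conv_exp[of "pi/4"] cis_conv_exp[of "-pi/4"]
  by (auto simp: cis.ctr cos_45 sin_45 complex_eq_iff)

text \<open>The scale is a positive real, so \<open>R A\<close> inherits the signs of its quotient
  by the scale, and these agree eventually with the nonzero signs of the limit.\<close>

lemma quadrant_eventually:
  assumes c: "c_g > 0"
    and lim: "((\<lambda>A. R A / of_real (branch_scale c_g A)) \<longlongrightarrow> \<zeta>) (at_right 0)"
  shows "Re \<zeta> > 0 \<Longrightarrow> \<forall>\<^sub>F A in at_right 0. Re (R A) > 0"
    and "Re \<zeta> < 0 \<Longrightarrow> \<forall>\<^sub>F A in at_right 0. Re (R A) < 0"
    and "Im \<zeta> > 0 \<Longrightarrow> \<forall>\<^sub>F A in at_right 0. Im (R A) > 0"
    and "Im \<zeta> < 0 \<Longrightarrow> \<forall>\<^sub>F A in at_right 0. Im (R A) < 0"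
proof -
  have pos: "\<forall>\<^sub>F A in at_right 0. branch_scale c_g A > 0"
    using eventually_at_right_less[of 0] by eventually_elim (rule branch_scale_pos[OF c])
  note re = tendsto_Re[OF lim] and im = tendsto_Im[OF lim]
  show "\<forall>\<^sub>F A in at_right 0. Re (R A) > 0" if "Re \<zeta> > 0"
    using order_tendstoD(1)[OF re that] pos by eventually_elim (simp add: zero_less_divide_iff)
  show "\<forall>\<^sub>F A in at_right 0. Re (R A) < 0" if "Re \<zeta> < 0"
    using order_tendstoD(2)[OF re that] pos by eventually_elim (simp add: divide_less_0_iff)
  show "\<forall>\<^sub>F A in at_right 0. Im (R A) > 0" if "Im \<zeta> > 0"
    using order_tendstoD(1)[OF im that] pos by eventually_elim (simp add: zero_less_divide_iff)
  show "\<forall>\<^sub>F A in at_right 0. Im (R A) < 0" if "Im \<zeta> < 0"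
    using order_tendstoD(2)[OF im that] pos by eventually_elim (simp add: divide_less_0_iff)
qed

lemma asymp_equiv_branch_scale_iff:
  assumes "c_g > 0" and "\<zeta> \<noteq> 0"
  shows "R \<sim>[at_right 0] (\<lambda>A. \<zeta> * of_real (c_g powr (1/4) * A powr (1/4))) \<longleftrightarrow>
    ((\<lambda>A. R A / of_real (branch_scale c_g A)) \<longlongrightarrow> \<zeta>) (at_right 0)"
  unfolding branch_scale_def[symmetric]
proof
  assume equiv: "R \<sim>[at_right 0] (\<lambda>A. \<zeta> * of_real (branch_scale c_g A))"
  \<comment> \<open>Asymptotic equivalence counts 0/0 as 1; excluding that case turns it into a
    limit of the plain quotient.\<close>
  have "\<forall>\<^sub>F A in at_right 0. R A \<noteq> 0 \<or> \<zeta> * of_real (branch_scale c_g A) \<noteq> 0"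
    using eventually_at_right_less[of 0]
    by eventually_elim (use assms branch_scale_pos in \<open>force\<close>)
  from tendsto_mult[OF tendsto_const[of \<zeta>] asymp_equivD_strong[OF equiv this]]
  show "((\<lambda>A. R A / of_real (branch_scale c_g A)) \<longlongrightarrow> \<zeta>) (at_right 0)"
    using assms(2) by simp
next
  assume "((\<lambda>A. R A / of_real (branch_scale c_g A)) \<longlongrightarrow> \<zeta>) (at_right 0)"
  then show "R \<sim>[at_right 0] (\<lambda>A. \<zeta> * of_real (branch_scale c_g A))"
    using assms(2) by (rule asymp_equivI'_const)
qed

lemma B1_branches_exist:
  assumes c: "c_g > 0"
  shows "\<exists>Bp Bm. B1_branches c_g c_\<sigma> Bp Bm"
proof -
  define r where "r = sqrt 2 / 2"
  have r: "r > 0" "r * r = 1/2" by (auto simp: r_def)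
  \<comment> \<open>For x^2 = y^2 = 1/2 the fourth power of x + iy is -4 x^2 y^2 = -1, so all four
    sign choices give admissible directions.\<close>
  have "(r * r) * (r * r) = 1/4" unfolding r(2) by simp
  then have r4: "Complex x y ^ 4 = - 1" if "x \<in> {r, -r}" "y \<in> {r, -r}" for x y
    using that by (auto simp: complex_eq_iff power4_eq_xxxx mult.assoc)
  obtain Rpp where pp: "\<And>A. lopatinskii_L c_g c_\<sigma> A (Rpp A) = 0"
    "((\<lambda>A. Rpp A / of_real (branch_scale c_g A)) \<longlongrightarrow> Complex r r) (at_right 0)"
    using lopatinskii_root_branch[OF r4 c] by blast
  obtain Rpm where pm: "\<And>A. lopatinskii_L c_g c_\<sigma> A (Rpm A) = 0"
    "((\<lambda>A. Rpm A / of_real (branch_scale c_g A)) \<longlongrightarrow> Complex r (-r)) (at_right 0)"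
    using lopatinskii_root_branch[OF r4 c] by blast
  obtain Rmp where mp: "\<And>A. lopatinskii_L c_g c_\<sigma> A (Rmp A) = 0"
    "((\<lambda>A. Rmp A / of_real (branch_scale c_g A)) \<longlongrightarrow> Complex (-r) r) (at_right 0)"
    using lopatinskii_root_branch[OF r4 c] by blast
  obtain Rmm where mm: "\<And>A. lopatinskii_L c_g c_\<sigma> A (Rmm A) = 0"
    "((\<lambda>A. Rmm A / of_real (branch_scale c_g A)) \<longlongrightarrow> Complex (-r) (-r)) (at_right 0)"
    using lopatinskii_root_branch[OF r4 c] by blast
  note ppq = quadrant_eventually[OF c pp(2)]
  note pmq = quadrant_eventually[OF c pm(2)]
  note mpq = quadrant_eventually[OF c mp(2)]
  note mmq = quadrant_eventually[OF c mm(2)]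
  have "\<forall>\<^sub>F A in at_right 0. Re (Rpp A) > 0 \<and> Im (Rpp A) > 0 \<and> Re (Rpm A) > 0 \<and> Im (Rpm A) < 0
     \<and> Re (Rmp A) < 0 \<and> Im (Rmp A) > 0 \<and> Re (Rmm A) < 0 \<and> Im (Rmm A) < 0"
    using ppq(1,3) pmq(1,4) mpq(2,3) mmq(2,4) r(1) by (simp add: eventually_conj_iff)
  then have "\<forall>\<^sub>F A in at_right 0. Rpp A \<noteq> Rpm A \<and>
      {B. lopatinskii_L c_g c_\<sigma> A B = 0 \<and> 0 < Re B} = {Rpp A, Rpm A}"
  proof eventually_elim
    case (elim A)
    let ?S = "{Rpp A, Rpm A, Rmp A, Rmm A}"
    let ?p = "lopatinskii_poly c_g c_\<sigma> A"
    \<comment> \<open>The sign patterns of real and imaginary parts differ pairwise. Four distinct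
      roots exhaust the degree bound, so \<open>?S\<close> is the whole root set.\<close>
    have distinct: "card ?S = 4"
      using elim by (subst card_insert_disjoint; auto)+
    have "?p \<noteq> 0" using degree_lopatinskii_poly[of c_g c_\<sigma> A] by auto
    then have "finite {B. poly ?p B = 0}" "card {B. poly ?p B = 0} \<le> 4"
      using poly_roots_finite card_poly_roots_bound[of ?p] degree_lopatinskii_poly by auto
    moreover have "?S \<subseteq> {B. poly ?p B = 0}"
      by (simp add: poly_lopatinskii_poly pp(1) pm(1) mp(1) mm(1))
    ultimately have "?S = {B. poly ?p B = 0}"
      using distinct by (intro card_seteq) auto
    then have "{B. lopatinskii_L c_g c_\<sigma> A B = 0 \<and> 0 < Re B} = {B \<in> ?S. 0 < Re B}"
      by (auto simp: poly_lopatinskii_poly)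
    also have "\<dots> = {Rpp A, Rpm A}" using elim by auto
    finally show ?case using elim by auto
  qed
  moreover have "Complex r r \<noteq> 0" "Complex r (-r) \<noteq> 0"
    using r(1) by (auto simp: complex_eq_iff)
  ultimately have "B1_branches c_g c_\<sigma> Rpp Rpm"
    unfolding B1_branches_def exp_pi_quarter exp_minus_pi_quarter r_def[symmetric]
    using asymp_equiv_branch_scale_iff[OF c] pp(2) pm(2) by blast
  then show ?thesis by blast
qed

section \<open>Return to lambda and to the frequency variable\<close>

text \<open>Positive real part selects the principal square root of \<open>(B A)^2\<close>. Hence a
  root of the quartic in the right half-plane gives a genuine zero lambda of the
  determinant.\<close>

lemma symbol_B_root_lambda: "Re (B A) > 0 \<Longrightarrow> symbol_B A (root_lambda B A) = B A"
  by (simp add: symbol_B_def root_lambda_def csqrt_square)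

text \<open>The punctured neighbourhood keeps the norm positive, so one-sided statements in
  \<open>A\<close> pull back to the frequency variable.\<close>

lemma filterlim_norm_at_right_0: "filterlim norm (at_right 0) (at (0 :: 'a::real_normed_vector))"
  unfolding filterlim_at by (auto intro!: tendsto_norm_zero simp: eventually_at_filter)

text \<open>The existence conjunct keeps the claim about all branches from being vacuous; the
  cardinality condition makes \<open>real ^ 'n\<close> the space of dimension N - 1.\<close>

theorem mainTheorem2:
  fixes N :: nat and c_g c_\<sigma> :: real
  assumes "N \<ge> 2" and "CARD('n::finite) = N - 1"
    and "c_g > 0" and "c_\<sigma> > 0"
  shows "(\<exists>Bp Bm. B1_branches c_g c_\<sigma> Bp Bm) \<and>
    (\<forall>Bp Bm. B1_branches c_g c_\<sigma> Bp Bm \<longrightarrow>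
      (\<forall>\<^sub>F \<xi> in at (0 :: real ^ 'n).
         lopatinskii_L c_g c_\<sigma> (norm \<xi>) (symbol_B (norm \<xi>) (root_lambda Bp (norm \<xi>))) = 0 \<and>
         lopatinskii_L c_g c_\<sigma> (norm \<xi>) (symbol_B (norm \<xi>) (root_lambda Bm (norm \<xi>))) = 0) \<and>
      (\<lambda>\<xi>. root_lambda Bp (norm \<xi>)
           - (\<i> * of_real (c_g powr (1/2) * norm \<xi> powr (1/2)) - 2 * of_real (norm \<xi>) ^ 2))
        \<in> O[at (0 :: real ^ 'n)](\<lambda>\<xi>. of_real (norm \<xi> powr (5/2))) \<and>
      (\<lambda>\<xi>. root_lambda Bm (norm \<xi>)
           - (- \<i> * of_real (c_g powr (1/2) * norm \<xi> powr (1/2)) - 2 * of_real (norm \<xi>) ^ 2))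
        \<in> O[at (0 :: real ^ 'n)](\<lambda>\<xi>. of_real (norm \<xi> powr (5/2))))"
proof (intro conjI allI impI)
  show "\<exists>Bp Bm. B1_branches c_g c_\<sigma> Bp Bm"
    using B1_branches_exist assms(3) .
next
  fix Bp Bm
  assume branches: "B1_branches c_g c_\<sigma> Bp Bm"
  have "\<forall>\<^sub>F A in at_right 0. {B. lopatinskii_L c_g c_\<sigma> A B = 0 \<and> 0 < Re B} = {Bp A, Bm A}"
    using branches unfolding B1_branches_def by (auto elim: eventually_mono)
  then have roots: "\<forall>\<^sub>F A in at_right 0. lopatinskii_L c_g c_\<sigma> A (Bp A) = 0 \<and> 0 < Re (Bp A) \<and>
      lopatinskii_L c_g c_\<sigma> A (Bm A) = 0 \<and> 0 < Re (Bm A)"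
    by eventually_elim blast
  then have "\<forall>\<^sub>F A in at_right 0.
      lopatinskii_L c_g c_\<sigma> A (symbol_B A (root_lambda Bp A)) = 0 \<and>
      lopatinskii_L c_g c_\<sigma> A (symbol_B A (root_lambda Bm A)) = 0"
    by eventually_elim (simp add: symbol_B_root_lambda)
  then show "\<forall>\<^sub>F \<xi> in at (0 :: real ^ 'n).
      lopatinskii_L c_g c_\<sigma> (norm \<xi>) (symbol_B (norm \<xi>) (root_lambda Bp (norm \<xi>))) = 0 \<and>
      lopatinskii_L c_g c_\<sigma> (norm \<xi>) (symbol_B (norm \<xi>) (root_lambda Bm (norm \<xi>))) = 0"
    by (rule eventually_compose_filterlim[OF _ filterlim_norm_at_right_0])
  let ?\<zeta>p = "exp (\<i> * of_real pi / 4)" and ?\<zeta>m = "exp (- \<i> * of_real pi / 4)"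
  have limp: "((\<lambda>A. Bp A / of_real (branch_scale c_g A)) \<longlongrightarrow> ?\<zeta>p) (at_right 0)"
    and limm: "((\<lambda>A. Bm A / of_real (branch_scale c_g A)) \<longlongrightarrow> ?\<zeta>m) (at_right 0)"
    using branches asymp_equiv_branch_scale_iff[OF assms(3), of ?\<zeta>p Bp]
      asymp_equiv_branch_scale_iff[OF assms(3), of ?\<zeta>m Bm]
    unfolding B1_branches_def by auto
  \<comment> \<open>These squares are the two values of \<open>s\<close> in the expansion and give
    its sign for each branch.\<close>
  have sq: "?\<zeta>p ^ 2 = \<i>" "?\<zeta>m ^ 2 = - \<i>"
    unfolding exp_pi_quarter exp_minus_pi_quarter by (auto simp: complex_eq_iff power2_eq_square)
  note * = landau_o.big.compose[OF root_lambda_expansion filterlim_norm_at_right_0]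
  show "(\<lambda>\<xi>. root_lambda Bp (norm \<xi>)
           - (\<i> * of_real (c_g powr (1/2) * norm \<xi> powr (1/2)) - 2 * of_real (norm \<xi>) ^ 2))
        \<in> O[at (0 :: real ^ 'n)](\<lambda>\<xi>. of_real (norm \<xi> powr (5/2)))"
    by (rule *[OF sq(1) _ assms(3) limp]) (use roots in \<open>auto elim: eventually_mono\<close>)
  show "(\<lambda>\<xi>. root_lambda Bm (norm \<xi>)
           - (- \<i> * of_real (c_g powr (1/2) * norm \<xi> powr (1/2)) - 2 * of_real (norm \<xi>) ^ 2))
        \<in> O[at (0 :: real ^ 'n)](\<lambda>\<xi>. of_real (norm \<xi> powr (5/2)))"
    by (rule *[OF sq(2) _ assms(3) limm]) (use roots in \<open>auto elim: eventually_mono\<close>)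
qed

end
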